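(* Let $S\neq\mathbb{N}$ be a numerical semigroup with maximal ideal $M=S\setminus\{0\}$, let $a\in\mathbb{N}$ with $a\in M-2M$, and let $T=S+a$ be the dilatation of $S$ with respect to $a$. Then $S$ is almost symmetric if and only if $T$ is almost symmetric.
   Context: $\mathbb{N}$ denotes the nonnegative integers. A numerical semigroup $S$ is a submonoid of $(\mathbb{N},+)$ with $\mathbb{N}\setminus S$ finite; its maximal ideal is $M=S\setminus\{0\}$. The condition $a\in M-2M$ means $a+s_1+s_2\in M$ for all $s_1,s_2\in M$. For such $a\in\mathbb{N}$, the dilatation of $S$ with respect to $a$ is the numerical semigroup $S+a=\{0\}\cup\{s+a : s\in M\}$ (so here $S+a$ is not the full translate of $S$). $F(S)=\max(\mathbb{N}\setminus S)$ is the Frobenius number, and the canonical ideal of $S$ is $\Omega_S=\{x\in\mathbb{N} : F(S)-x\notin S\}$. $S$ is almost symmetric if $\Omega_S+M\subseteq M$, where $\Omega_S+M=\{x+s : x\in\Omega_S, s\in M\}$. *)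

theory Defs
  imports "HOL-Library.Set_Algebras"
begin

definition numerical_semigroup :: "nat set \<Rightarrow> bool" where
  "numerical_semigroup S \<longleftrightarrow>
     0 \<in> S \<and> (\<forall>x\<in>S. \<forall>y\<in>S. x + y \<in> S) \<and> finite (UNIV - S)"

definition maximal_ideal :: "nat set \<Rightarrow> nat set" where
  "maximal_ideal S = S - {0}"

text \<open>The natural numbers in \<open>M - 2M\<close>, the colon (not the set difference) of \<open>M\<close> by
  \<open>2M = M + M\<close>, where \<open>M\<close> is the maximal ideal of \<open>S\<close>.\<close>

definition M_colon_2M :: "nat set \<Rightarrow> nat set" where
  "M_colon_2M S =
     {a. \<forall>s\<^sub>1\<in>maximal_ideal S. \<forall>s\<^sub>2\<in>maximal_ideal S. a + s\<^sub>1 + s\<^sub>2 \<in> maximal_ideal S}"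

definition dilatation :: "nat set \<Rightarrow> nat \<Rightarrow> nat set" where
  "dilatation S a = {0} \<union> {s + a | s. s \<in> maximal_ideal S}"

text \<open>Only meaningful when \<open>S \<noteq> UNIV\<close>, since \<open>Max {}\<close> is unspecified.\<close>

definition frobenius :: "nat set \<Rightarrow> nat" where
  "frobenius S = Max (UNIV - S)"

text \<open>The difference is taken in the integers: every \<open>x > frobenius S\<close> belongs to the
  canonical ideal, whereas truncated subtraction on \<open>nat\<close> would give \<open>0 \<in> S\<close>.\<close>

definition canonical_ideal :: "nat set \<Rightarrow> nat set" where
  "canonical_ideal S = {x. int (frobenius S) - int x \<notin> int ` S}"

text \<open>The sum is the elementwise sum of sets.\<close>

definition almost_symmetric :: "nat set \<Rightarrow> bool" where
  "almost_symmetric S \<longleftrightarrow> canonical_ideal S + maximal_ideal S \<subseteq> maximal_ideal S"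

text \<open>For \<open>a \<in> M - 2M\<close> the dilatation is again a proper numerical semigroup, so the notions
  above apply to it.\<close>

lemma numerical_semigroup_dilatation:
  assumes "numerical_semigroup S" and "a \<in> M_colon_2M S"
  shows "numerical_semigroup (dilatation S a)"
proof -
  have "UNIV - dilatation S a \<subseteq> {..a} \<union> (\<lambda>n. n + a) ` (UNIV - S)"
  proof
    fix x assume x: "x \<in> UNIV - dilatation S a"
    show "x \<in> {..a} \<union> (\<lambda>n. n + a) ` (UNIV - S)"
    proof (cases "x \<le> a")
      case False
      define n where "n = x - a"
      have n: "x = n + a" "n \<noteq> 0" using False by (auto simp: n_def)
      with x have "n \<notin> S"
        by (auto simp: dilatation_def maximal_ideal_def)
      with n(1) show ?thesis by blast
    qed simp
  qed
  then have fin: "finite (UNIV - dilatation S a)"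
    using assms(1) unfolding numerical_semigroup_def
    by (meson finite_UnI finite_atMost finite_imageI finite_subset)
  have closed: "x + y \<in> dilatation S a"
    if xy: "x \<in> dilatation S a" "y \<in> dilatation S a" for x y
  proof (cases "x = 0 \<or> y = 0")
    case True
    then show ?thesis using xy by auto
  next
    case False
    then obtain s t where s: "s \<in> maximal_ideal S" "x = s + a"
      and t: "t \<in> maximal_ideal S" "y = t + a"
      using xy unfolding dilatation_def by auto
    have "a + s + t \<in> maximal_ideal S"
      using assms(2) s(1) t(1) unfolding M_colon_2M_def by blast
    moreover have "x + y = (a + s + t) + a" using s t by simp
    ultimately show ?thesis unfolding dilatation_def by blast
  qed
  have "0 \<in> dilatation S a" by (simp add: dilatation_def)
  with fin closed show ?thesis unfolding numerical_semigroup_def by blast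
qed

lemma dilatation_neq_UNIV:
  assumes "S \<noteq> UNIV" and "numerical_semigroup S"
  shows "dilatation S a \<noteq> UNIV"
proof -
  obtain n where n: "n \<notin> S" using assms(1) by blast
  then have "n \<noteq> 0" using assms(2) unfolding numerical_semigroup_def by metis
  then have "n + a \<notin> dilatation S a"
    using n unfolding dilatation_def maximal_ideal_def by auto
  then show ?thesis by blast
qed

end

theory Submission imports Defs begin

text \<open>Let \<open>F\<close> be the Frobenius number and \<open>M\<close> the maximal ideal of \<open>S\<close>. The maximal ideal
  of \<open>S + a\<close> is the translate \<open>M + a\<close> and its Frobenius number is \<open>F + a\<close>, so, cancelling \<open>a\<close>,
  \<open>S + a\<close> is almost symmetric iff its canonical ideal carries \<open>M\<close> into \<open>M\<close>. The two canonical
  ideals differ at most in \<open>F\<close> and \<open>F + a\<close>, and adding a nonzero number to either exceeds \<open>F\<close>,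
  hence lands in \<open>M\<close>.\<close>

lemma frobenius_notin:
  assumes "numerical_semigroup S" "S \<noteq> UNIV"
  shows "frobenius S \<notin> S"
  using Max_in[of "UNIV - S"] assms unfolding frobenius_def numerical_semigroup_def by auto

lemma less_frobenius_mem:
  assumes "numerical_semigroup S" "frobenius S < x"
  shows "x \<in> S"
proof (rule ccontr)
  assume "x \<notin> S"
  then have "x \<le> frobenius S"
    using assms(1) unfolding frobenius_def numerical_semigroup_def by (intro Max_ge) auto
  with assms(2) show False by simp
qed

lemma add_mem_maximal_ideal:
  assumes "numerical_semigroup S" "frobenius S \<le> x" "s \<in> maximal_ideal S"
  shows "x + s \<in> maximal_ideal S"
  using less_frobenius_mem[of S "x + s"] assms by (auto simp: maximal_ideal_def)

lemma dilatation_iff: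
  "y \<in> dilatation S a \<longleftrightarrow> y = 0 \<or> a \<le> y \<and> y - a \<in> maximal_ideal S"
  unfolding dilatation_def by (force intro: le_add_diff_inverse2[symmetric])

lemma maximal_ideal_dilatation:
  "maximal_ideal (dilatation S a) = (\<lambda>s. s + a) ` maximal_ideal S"
  by (auto simp: dilatation_def maximal_ideal_def)

lemma frobenius_dilatation:
  assumes "numerical_semigroup S" "S \<noteq> UNIV" "a \<in> M_colon_2M S"
  shows "frobenius (dilatation S a) = frobenius S + a"
  unfolding frobenius_def[of "dilatation S a"]
proof (rule Max_eqI)
  show "finite (UNIV - dilatation S a)"
    using numerical_semigroup_dilatation[OF assms(1,3)] by (simp add: numerical_semigroup_def)
  show "y \<le> frobenius S + a" if "y \<in> UNIV - dilatation S a" for y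
  proof (rule ccontr)
    assume y: "\<not> y \<le> frobenius S + a"
    then have "y - a \<in> S" by (intro less_frobenius_mem[OF assms(1)]) simp
    with y that show False by (simp add: dilatation_iff maximal_ideal_def)
  qed
  \<comment> \<open>Needed so that \<open>frobenius S + a\<close> is not the adjoined element 0 of
    the dilatation, even when \<open>a = 0\<close>.\<close>
  have "frobenius S \<noteq> 0"
    using frobenius_notin[OF assms(1,2)] assms(1) by (metis numerical_semigroup_def)
  then show "frobenius S + a \<in> UNIV - dilatation S a"
    using frobenius_notin[OF assms(1,2)] by (simp add: dilatation_iff maximal_ideal_def)
qed

text \<open>Returns from integers to \<open>nat\<close>: the guard confines the truncated
  subtraction to the range where it is exact.\<close>

lemma canonical_ideal_iff:
  "x \<in> canonical_ideal S \<longleftrightarrow> (x \<le> frobenius S \<longrightarrow> frobenius S - x \<notin> S)"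
proof (cases "x \<le> frobenius S")
  case True
  then have "int (frobenius S) - int x = int (frobenius S - x)" by simp
  then show ?thesis
    using True unfolding canonical_ideal_def by (simp add: inj_image_mem_iff del: of_nat_diff)
qed (auto simp: canonical_ideal_def)

text \<open>Below \<open>frobenius S\<close>, both memberships ask whether the nonzero number
  \<open>frobenius S - x\<close> avoids \<open>S\<close>. Strictly between the excluded values,
  \<open>frobenius S + a - x\<close> lies strictly between 0 and \<open>a\<close>, where the
  dilatation has no element, so both hold. Above them both hold trivially.\<close>

lemma canonical_ideal_dilatation_iff:
  assumes "numerical_semigroup S" "S \<noteq> UNIV" "a \<in> M_colon_2M S"
    and "x \<noteq> frobenius S" "x \<noteq> frobenius S + a"
  shows "x \<in> canonical_ideal (dilatation S a) \<longleftrightarrow> x \<in> canonical_ideal S"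
proof -
  have "frobenius S + a - x - a = frobenius S - x" by simp
  then show ?thesis
    using assms(4,5)
    by (auto simp: canonical_ideal_iff frobenius_dilatation[OF assms(1-3)] dilatation_iff
        maximal_ideal_def)
qed

lemma almost_symmetric_iff:
  "almost_symmetric S \<longleftrightarrow>
     (\<forall>x\<in>canonical_ideal S. \<forall>s\<in>maximal_ideal S. x + s \<in> maximal_ideal S)"
  unfolding almost_symmetric_def by (auto elim!: set_plus_elim)

lemma almost_symmetric_dilatation_iff:
  "almost_symmetric (dilatation S a) \<longleftrightarrow>
     (\<forall>x\<in>canonical_ideal (dilatation S a). \<forall>s\<in>maximal_ideal S. x + s \<in> maximal_ideal S)"
proof -
  have "x + (s + a) \<in> (\<lambda>s. s + a) ` maximal_ideal S \<longleftrightarrow> x + s \<in> maximal_ideal S" for x s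
    by (auto simp: add.assoc[symmetric])
  then show ?thesis
    by (simp add: almost_symmetric_iff maximal_ideal_dilatation)
qed

theorem proposition3p2:
  fixes S T :: "nat set" and a :: nat
  assumes "numerical_semigroup S"
    and "S \<noteq> UNIV"
    and "a \<in> M_colon_2M S"
    and "T = dilatation S a"
  shows "almost_symmetric S \<longleftrightarrow> almost_symmetric T"
proof -
  \<comment> \<open>Implications are compared, not memberships, since the latter can differ at the
    two exceptional values.\<close>
  have "(x \<in> canonical_ideal S \<longrightarrow> x + s \<in> maximal_ideal S) \<longleftrightarrow>
      (x \<in> canonical_ideal T \<longrightarrow> x + s \<in> maximal_ideal S)" if "s \<in> maximal_ideal S" for x s
  proof (cases "x = frobenius S \<or> x = frobenius S + a")
    case True
    then show ?thesis using add_mem_maximal_ideal[OF assms(1) _ that] by auto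
  next
    case False
    then show ?thesis using canonical_ideal_dilatation_iff[OF assms(1-3)] assms(4) by simp
  qed
  then show ?thesis
    unfolding assms(4) almost_symmetric_dilatation_iff almost_symmetric_iff[of S] by blast
qed

end
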